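(* The 4-parametric Mittag-Leffler function $$E_{\alpha_1,\beta_1;\alpha_2,\beta_2}(z) = \sum_{k=0}^{\infty} \frac{z^k}{\Gamma(\alpha_1 k + \beta_1)\, \Gamma(\alpha_2 k + \beta_2)},\qquad z\in\mathbb{C},$$ is differentiable with respect to each of the complex parameters $\alpha_1,\beta_1,\alpha_2,\beta_2$ in the domain $$D_4=\{(\alpha_1,\beta_1,\alpha_2,\beta_2)\in\mathbb{C}^4:\ \mathrm{Re}(\alpha_1+\alpha_2)>0,\ \beta_1\in\mathbb{C},\ \beta_2\in\mathbb{C}\},$$ and for all $(\alpha_1,\beta_1,\alpha_2,\beta_2)\in D_4$, all $z\in\mathbb{C}$ and $j=1,2$, $$\frac{\partial E_{\alpha_1,\beta_1;\alpha_2,\beta_2}(z)}{\partial \alpha_j} = - \sum_{k=1}^{\infty} \frac{k\, \psi(\alpha_j k + \beta_j)}{\Gamma(\alpha_1 k + \beta_1)\, \Gamma(\alpha_2 k + \beta_2)}\, z^k,$$ $$\frac{\partial E_{\alpha_1,\beta_1;\alpha_2,\beta_2}(z)}{\partial \beta_j} = - \sum_{k=0}^{\infty} \frac{\psi(\alpha_j k + \beta_j)}{\Gamma(\alpha_1 k + \beta_1)\, \Gamma(\alpha_2 k + \beta_2)}\, z^k .$$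
   Context: $1/\Gamma$ is understood as an entire function (equal to $0$ at $0,-1,-2,\dots$). $\psi=\Gamma'/\Gamma$ is the digamma function. The ratio $\psi(w)/\Gamma(w)$ is understood as an entire function of $w$, namely $\psi(w)/\Gamma(w)=-(1/\Gamma)'(w)$, its removable singularities at $w=0,-1,-2,\dots$ being filled in by continuity; in the formulas the factor $\psi(\alpha_jk+\beta_j)$ is combined with $1/\Gamma(\alpha_jk+\beta_j)$ in this sense. *)

theory Defs
  imports "HOL-Complex_Analysis.Complex_Analysis"
begin

text \<open>
  \<open>rGamma\<close> is the library's entire function \<open>1/\<Gamma>\<close> (zero at \<open>0, -1, -2, \<dots>\<close>), so the
  terms below need no side conditions.  Outside \<open>D4\<close> the series may diverge, and
  the value of \<open>mittag_leffler4\<close> is then meaningless.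
\<close>

definition mittag_leffler4 ::
  "complex \<Rightarrow> complex \<Rightarrow> complex \<Rightarrow> complex \<Rightarrow> complex \<Rightarrow> complex" where
  "mittag_leffler4 \<alpha>\<^sub>1 \<beta>\<^sub>1 \<alpha>\<^sub>2 \<beta>\<^sub>2 z =
     (\<Sum>k. rGamma (\<alpha>\<^sub>1 * of_nat k + \<beta>\<^sub>1) * rGamma (\<alpha>\<^sub>2 * of_nat k + \<beta>\<^sub>2) * z ^ k)"

definition D4 :: "(complex \<times> complex \<times> complex \<times> complex) set" where
  "D4 = {(\<alpha>\<^sub>1, \<beta>\<^sub>1, \<alpha>\<^sub>2, \<beta>\<^sub>2). Re (\<alpha>\<^sub>1 + \<alpha>\<^sub>2) > 0}"

text \<open>
  The entire function \<open>\<psi>/\<Gamma>\<close>: \<open>remove_sings\<close> takes the limit at every point, so the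
  library's values of \<open>Digamma\<close> and \<open>Gamma\<close> at their poles play no role.
\<close>

definition Digamma_over_Gamma :: "complex \<Rightarrow> complex" where
  "Digamma_over_Gamma = remove_sings (\<lambda>w. Digamma w / Gamma w)"

lemma Digamma_over_Gamma_eq_deriv: "Digamma_over_Gamma w = - deriv rGamma w"
proof -
  have "deriv rGamma holomorphic_on UNIV"
    by (intro holomorphic_deriv holomorphic_rGamma) auto
  then have "deriv rGamma analytic_on {w}"
    by (rule holomorphic_on_imp_analytic_at) auto
  then have "isCont (deriv rGamma) w"
    by (rule analytic_at_imp_isCont)
  then have lim: "((\<lambda>v. - deriv rGamma v) \<longlongrightarrow> - deriv rGamma w) (at w)"
    by (intro tendsto_minus) (simp add: isContD)
  have "open (- (\<int>\<^sub>\<le>\<^sub>0 - {w}))"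
    using nonpos_Ints_subset_Ints by (intro open_Compl closed_subset_Ints) blast
  then have "\<forall>\<^sub>F v in at w. v \<in> - (\<int>\<^sub>\<le>\<^sub>0 - {w})"
    by (rule eventually_at_in_open') auto
  moreover have "\<forall>\<^sub>F v in at w. v \<noteq> w"
    by (simp add: eventually_at_filter)
  ultimately have "\<forall>\<^sub>F v in at w. - deriv rGamma v = Digamma v / Gamma v"
  proof eventually_elim
    case (elim v)
    then have "v \<notin> \<int>\<^sub>\<le>\<^sub>0"
      by auto
    then have "deriv rGamma v = - rGamma v * Digamma v"
      by (intro DERIV_imp_deriv has_field_derivative_rGamma_no_nonpos_int)
    then show ?case
      by (simp add: Gamma_def divide_inverse mult.commute)
  qed
  with lim have "((\<lambda>v. Digamma v / Gamma v) \<longlongrightarrow> - deriv rGamma w) (at w)"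
    by (rule Lim_transform_eventually)
  then show ?thesis
    unfolding Digamma_over_Gamma_def by (rule remove_sings_eqI)
qed

lemma Digamma_over_Gamma_no_nonpos_Int:
  assumes "w \<notin> \<int>\<^sub>\<le>\<^sub>0"
  shows "Digamma_over_Gamma w = Digamma w / Gamma w"
proof -
  have "deriv rGamma w = - rGamma w * Digamma w"
    using assms by (intro DERIV_imp_deriv has_field_derivative_rGamma_no_nonpos_int)
  then show ?thesis
    by (simp add: Digamma_over_Gamma_eq_deriv Gamma_def divide_inverse mult.commute)
qed

end

theory Submission
  imports Defs
begin

text \<open>
  The real parts of \<open>\<alpha>\<^sub>1\<close> and \<open>\<alpha>\<^sub>2\<close> may have opposite signs, so one needs a bound on
  \<open>1/\<Gamma>\<close> in the whole plane: \<open>\<bar>1/\<Gamma>(s)\<bar> \<le> exp (C k - Re s ln k)\<close> whenever \<open>\<bar>s\<bar> \<le> R k\<close>, where \<open>C\<close>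
  depends only on \<open>R\<close>.  It follows from Gauss's product without Stirling's formula or
  the reflection formula: truncate the product after \<open>k\<close> factors, estimate the finite part
  trivially, and bound the tail by \<open>\<bar>1 + w\<bar> \<le> exp (Re w + \<bar>w\<bar>\<^sup>2/2)\<close>.  In the product of two such
  bounds only \<open>Re (\<alpha>\<^sub>1 + \<alpha>\<^sub>2)\<close> enters at the leading order \<open>k ln k\<close>, so the series of
  holomorphic functions converges locally uniformly in the parameters and may be
  differentiated termwise.
\<close>

section \<open>Growth of \<open>1/\<Gamma>\<close> from the partial products of Gauss\<close>

text \<open>Squaring turns the norm into \<open>1 + x\<close> with \<open>x\<close> real, where
  \<open>1 + x \<le> exp x\<close> applies. Keeping \<open>Re w\<close> instead of
  \<open>norm w\<close> lets the first-order terms of the product cancel later.\<close>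

lemma norm_one_plus_le_exp: "norm (1 + w :: complex) \<le> exp (Re w + (norm w)\<^sup>2 / 2)"
proof -
  have "(norm (1 + w))\<^sup>2 = 1 + (2 * Re w + (norm w)\<^sup>2)"
    unfolding cmod_power2 by (simp add: power2_eq_square algebra_simps)
  also have "\<dots> \<le> exp (2 * Re w + (norm w)\<^sup>2)"
    by (rule exp_ge_add_one_self)
  also have "\<dots> = (exp (Re w + (norm w)\<^sup>2 / 2))\<^sup>2"
    by (simp flip: exp_double)
  finally show ?thesis
    by (rule power2_le_imp_le) simp
qed

text \<open>Consecutive partial products differ by the factor
  \<open>(1 + s/(n+1)) * exp (- s * d)\<close> with \<open>d = ln (n+1) - ln n\<close>. To first
  order in \<open>s\<close> the exponents cancel, and the remainder of order \<open>1/n^2\<close> is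
  written as \<open>1/n - 1/(n+1)\<close> so that it telescopes.\<close>

lemma norm_rGamma_series_Suc_le:
  fixes s :: complex
  assumes "n > 0"
  shows "norm (rGamma_series s (Suc n)) \<le>
    norm (rGamma_series s n) * exp (((norm s)\<^sup>2 + norm s) * (1 / n - 1 / Suc n))"
proof -
  define m where "m = real n"
  have m: "m > 0" using assms by (simp add: m_def)
  define d where "d = ln (m + 1) - ln m"
  have d: "1 / (m + 1) \<le> d" "d \<le> 1 / m"
    using ln_diff_le[of m "m + 1"] ln_diff_le[of "m + 1" m] m by (auto simp: d_def field_simps)
  have eq: "rGamma_series s (Suc n) =
      rGamma_series s n * (1 + s / of_real (m + 1)) * exp (- s * of_real d)"
  proof -
    have "exp (s * of_real (ln (m + 1))) = exp (s * of_real (ln m)) * exp (s * of_real d)"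
      by (simp add: d_def algebra_simps flip: exp_add)
    moreover have "of_nat n + 1 \<noteq> (0 :: complex)"
      using of_nat_neq_0[of n, where 'a = complex] by (simp add: add.commute)
    ultimately show ?thesis
      unfolding rGamma_series_def m_def
      by (simp add: pochhammer_Suc exp_minus field_simps)
  qed
  have "norm ((1 + s / of_real (m + 1)) * exp (- s * of_real d))
      \<le> exp (Re (s / of_real (m + 1)) + (norm (s / of_real (m + 1)))\<^sup>2 / 2) * exp (- Re s * d)"
    using norm_one_plus_le_exp[of "s / of_real (m + 1)"] by (simp add: norm_mult)
  also have "\<dots> = exp ((norm s)\<^sup>2 * (1 / (2 * (m + 1)\<^sup>2)) + (- Re s) * (d - 1 / (m + 1)))"
  proof -
    have "norm (s / of_real (m + 1)) = norm s / (m + 1)"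
      using m unfolding norm_divide norm_of_real by simp
    moreover have "Re (s / of_real (m + 1)) = Re s / (m + 1)"
      by (rule Re_divide_of_real)
    ultimately show ?thesis
      by (simp add: power_divide algebra_simps flip: exp_add)
  qed
  also have "\<dots> \<le> exp ((norm s)\<^sup>2 * (1 / m - 1 / (m + 1)) + norm s * (1 / m - 1 / (m + 1)))"
  proof -
    \<comment> \<open>The lower bound on \<open>d\<close> makes the second factor nonnegative, so
      both signs of \<open>Re s\<close> are covered by \<open>- Re s \<le> norm s\<close>.\<close>
    have "(- Re s) * (d - 1 / (m + 1)) \<le> norm s * (1 / m - 1 / (m + 1))"
      using d abs_Re_le_cmod[of s] by (intro mult_mono) auto
    moreover have "1 / (2 * (m + 1)\<^sup>2) \<le> 1 / m - 1 / (m + 1)"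
    proof -
      have "1 / m - 1 / (m + 1) = 1 / (m * (m + 1))"
        using m by (simp add: field_simps)
      moreover have "m * (m + 1) \<le> 2 * (m + 1)\<^sup>2" "m * (m + 1) > 0"
        using m by (simp_all add: power2_eq_square algebra_simps add_pos_pos)
      ultimately show ?thesis
        by (simp only: frac_le)
    qed
    ultimately show ?thesis
      by (simp only: exp_le_cancel_iff) (intro add_mono mult_left_mono; simp)
  qed
  finally have "norm (rGamma_series s n) * norm ((1 + s / of_real (m + 1)) * exp (- s * of_real d))
      \<le> norm (rGamma_series s n) * exp (((norm s)\<^sup>2 + norm s) * (1 / m - 1 / (m + 1)))"
    by (intro mult_left_mono) (simp_all only: distrib_right[of "(norm s)\<^sup>2"] norm_ge_zero)
  then show ?thesis
    unfolding eq by (simp add: m_def norm_mult mult.assoc add.commute)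
qed

text \<open>The one-step estimates telescope from \<open>k\<close> to \<open>n\<close>, and the
  partial products tend to \<open>rGamma s\<close>. For \<open>norm s \<le> R * k\<close> the loss
  is only exponential in \<open>k\<close>.\<close>

lemma norm_rGamma_le_rGamma_series:
  fixes s :: complex
  assumes "k > 0"
  shows "norm (rGamma s) \<le> norm (rGamma_series s k) * exp (((norm s)\<^sup>2 + norm s) / k)"
proof (rule Lim_bounded)
  show "(\<lambda>n. norm (rGamma_series s n)) \<longlonglongrightarrow> norm (rGamma s)"
    by (intro tendsto_norm rGamma_series_LIMSEQ)
  have *: "norm (rGamma_series s n) \<le>
      norm (rGamma_series s k) * exp (((norm s)\<^sup>2 + norm s) * (1 / k - 1 / n))" if "n \<ge> k" for n
    using that
  proof (induction n rule: dec_induct)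
    case (step n)
    let ?c = "(norm s)\<^sup>2 + norm s"
    have "norm (rGamma_series s (Suc n)) \<le> norm (rGamma_series s n) * exp (?c * (1 / n - 1 / Suc n))"
      using assms step by (intro norm_rGamma_series_Suc_le) auto
    also have "\<dots> \<le> norm (rGamma_series s k) * exp (?c * (1 / k - 1 / n)) * exp (?c * (1 / n - 1 / Suc n))"
      by (intro mult_right_mono step) auto
    also have "\<dots> = norm (rGamma_series s k) * exp (?c * (1 / k - 1 / Suc n))"
      by (simp only: mult.assoc exp_add[symmetric] distrib_left[symmetric]) simp
    finally show ?case .
  qed auto
  show "\<forall>n\<ge>k. norm (rGamma_series s n) \<le> norm (rGamma_series s k) * exp (((norm s)\<^sup>2 + norm s) / k)"
  proof (intro allI impI)
    fix n assume "n \<ge> k"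
    have "((norm s)\<^sup>2 + norm s) * (1 / k - 1 / n) \<le> ((norm s)\<^sup>2 + norm s) * (1 / k)"
      by (intro mult_left_mono) auto
    then show "norm (rGamma_series s n) \<le> norm (rGamma_series s k) * exp (((norm s)\<^sup>2 + norm s) / k)"
      by (intro order.trans[OF *[OF \<open>n \<ge> k\<close>]] mult_left_mono) auto
  qed
qed

text \<open>The quotient \<open>k^k / k!\<close> is a single term of the positive series for
  \<open>exp k\<close>.\<close>

lemma power_self_le_exp_fact: "real k ^ k \<le> exp (real k) * fact k"
proof -
  have sums: "(\<lambda>n. real k ^ n /\<^sub>R fact n) sums exp (real k)"
    by (rule exp_converges)
  have "(\<Sum>n\<in>{k}. real k ^ n /\<^sub>R fact n) \<le> (\<Sum>n. real k ^ n /\<^sub>R fact n)"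
    using sums by (intro sum_le_suminf) (auto simp: sums_iff)
  then have "real k ^ k /\<^sub>R fact k \<le> exp (real k)"
    using sums by (simp add: sums_iff)
  then show ?thesis
    by (simp add: field_simps)
qed

text \<open>Each of the \<open>k + 1\<close> factors of the numerator is at most
  \<open>(R + 1) * k\<close>. The factorial in the denominator absorbs \<open>k^k\<close>, the
  factor \<open>exp (s * ln k)\<close> there gives the term \<open>Re s * ln k\<close>, and
  everything else is exponential in \<open>k\<close>.\<close>

lemma norm_rGamma_series_le:
  fixes s :: complex
  assumes k: "k > 0" and R: "norm s \<le> R * k"
  shows "norm (rGamma_series s k) \<le> exp ((2 * R + 2) * k - Re s * ln k)"
proof -
  have "R * k \<ge> 0" using norm_ge_zero R by (rule order.trans)
  with k have R0: "R \<ge> 0" by (simp add: zero_le_mult_iff)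
  have "norm (pochhammer s (k + 1)) = (\<Prod>j\<le>k. norm (s + of_nat j))"
    by (simp add: pochhammer_prod prod_norm atLeast0LessThan lessThan_Suc_atMost)
  also have "\<dots> \<le> (\<Prod>j\<le>k. (R + 1) * k)"
  proof (intro prod_mono conjI norm_ge_zero)
    fix j assume "j \<in> {..k}"
    then have "norm (s + of_nat j) \<le> R * k + k"
      using R norm_triangle_ineq[of s "of_nat j"] by simp
    then show "norm (s + of_nat j) \<le> (R + 1) * k" by (simp add: algebra_simps)
  qed
  also have "\<dots> = (R + 1) ^ (k + 1) * real k * real k ^ k"
    by (simp add: power_mult_distrib)
  also have "\<dots> \<le> exp R ^ (k + 1) * exp (real k) * (exp (real k) * fact k)"
  proof (intro mult_mono power_mono power_self_le_exp_fact)
    show "R + 1 \<le> exp R" "real k \<le> exp (real k)"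
      using exp_ge_add_one_self[of R] exp_ge_add_one_self[of "real k"] by linarith+
  qed (use R0 in auto)
  also have "\<dots> \<le> exp (2 * R * k) * exp (real k) * (exp (real k) * fact k)"
  proof -
    \<comment> \<open>Here \<open>k \<ge> 1\<close> turns the \<open>k + 1\<close> factors into an
      exponent proportional to \<open>k\<close>.\<close>
    have "R * (k + 1) \<le> R * (2 * k)"
      using R0 k by (intro mult_left_mono) auto
    then have "exp R ^ (k + 1) \<le> exp (2 * R * k)"
      unfolding exp_of_nat_mult[symmetric] by (simp add: algebra_simps)
    then show ?thesis by (intro mult_right_mono) auto
  qed
  also have "\<dots> = exp ((2 * R + 2) * k) * fact k"
    by (simp add: algebra_simps flip: exp_add)
  finally have "norm (pochhammer s (k + 1)) / fact k \<le> exp ((2 * R + 2) * k)"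
    by (simp add: field_simps)
  then have "norm (pochhammer s (k + 1)) / fact k / exp (Re s * ln k)
      \<le> exp ((2 * R + 2) * k) / exp (Re s * ln k)"
    by (intro divide_right_mono) auto
  then show ?thesis
    by (simp add: rGamma_series_def norm_divide norm_mult exp_diff)
qed

text \<open>Cutting the product at the \<open>k\<close> that scales \<open>norm s\<close> balances
  both parts: the finite part contributes \<open>(2 * R + 2) * k\<close> and the tail
  \<open>(R^2 + R) * k\<close>, which add up to \<open>(R + 1) * (R + 2) * k\<close>.\<close>

lemma norm_rGamma_le:
  fixes s :: complex and R :: real and k :: nat
  assumes k: "k > 0" and R: "norm s \<le> R * k"
  shows "norm (rGamma s) \<le> exp ((R + 1) * (R + 2) * k - Re s * ln k)"
proof -
  have k1: "real k \<ge> 1" using k by simp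
  have "R * k \<ge> 0" using norm_ge_zero R by (rule order.trans)
  with k have R0: "R \<ge> 0" by (simp add: zero_le_mult_iff)
  have "((norm s)\<^sup>2 + norm s) / k \<le> ((R * k)\<^sup>2 + R * k) / k"
    using R by (intro divide_right_mono add_mono power_mono) auto
  also have "\<dots> = R\<^sup>2 * k + R"
    using k by (simp add: field_simps power2_eq_square)
  also have "\<dots> \<le> R\<^sup>2 * k + R * k"
    using mult_left_mono[OF k1 R0] by simp
  finally have "norm (rGamma_series s k) * exp (((norm s)\<^sup>2 + norm s) / k)
      \<le> exp ((2 * R + 2) * k - Re s * ln k) * exp (R\<^sup>2 * k + R * k)"
    using assms by (intro mult_mono norm_rGamma_series_le) auto
  also have "\<dots> = exp ((R + 1) * (R + 2) * k - Re s * ln k)"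
    by (simp add: algebra_simps power2_eq_square flip: exp_add)
  finally show ?thesis
    using norm_rGamma_le_rGamma_series[OF k, of s] by simp
qed

section \<open>Uniform geometric bound on the terms of the series\<close>

text \<open>The \<open>k\<close>-th root of the bound on a term is
  \<open>exp C * norm z * k powr - \<delta>\<close>, which tends to 0. As it involves the parameters
  only through \<open>R\<close> and \<open>\<delta>\<close>, one threshold for \<open>k\<close>
  serves them all.\<close>

lemma eventually_norm_mittag_leffler4_term_le:
  fixes z :: complex and R \<delta> :: real
  assumes "\<delta> > 0" "R \<ge> 0"
  shows "\<forall>\<^sub>F k in sequentially. \<forall>a1 b1 a2 b2.
    norm a1 \<le> R \<longrightarrow> norm b1 \<le> R \<longrightarrow> norm a2 \<le> R \<longrightarrow> norm b2 \<le> R \<longrightarrow> Re (a1 + a2) \<ge> \<delta> \<longrightarrow>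
    norm (rGamma (a1 * of_nat k + b1) * rGamma (a2 * of_nat k + b2) * z ^ k) \<le> (1 / 2) ^ k"
proof -
  \<comment> \<open>Two copies of the constant of \<open>norm_rGamma_le\<close> at radius
    \<open>2 * R\<close>, because \<open>norm (a * k + b) \<le> 2 * R * k\<close> for
    \<open>k \<ge> 1\<close>. The last \<open>2 * R\<close> pays for \<open>b1\<close> and
    \<open>b2\<close>, whose contribution \<open>2 * R * ln k\<close> is at most
    \<open>2 * R * k\<close>.\<close>
  define C where "C = 2 * ((2 * R + 1) * (2 * R + 2)) + 2 * R"
  have "((\<lambda>k. exp C * norm z * real k powr - \<delta>) \<longlongrightarrow> exp C * norm z * 0) sequentially"
    using assms by (intro tendsto_intros tendsto_neg_powr filterlim_real_sequentially) auto
  then have "\<forall>\<^sub>F k in sequentially. exp C * norm z * real k powr - \<delta> < 1 / 2"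
    by (rule order_tendstoD) simp
  moreover have "\<forall>\<^sub>F k in sequentially. k > (0 :: nat)"
    by (rule eventually_gt_at_top)
  ultimately show ?thesis
  proof eventually_elim
    case (elim k)
    have k: "k > 0" "real k \<ge> 1" using elim by auto
    show ?case
    proof (intro allI impI)
      fix a1 b1 a2 b2 :: complex
      assume bd: "norm a1 \<le> R" "norm b1 \<le> R" "norm a2 \<le> R" "norm b2 \<le> R" "Re (a1 + a2) \<ge> \<delta>"
      have *: "norm (rGamma (a * of_nat k + b))
          \<le> exp ((2 * R + 1) * (2 * R + 2) * k - Re (a * of_nat k + b) * ln k)"
        if "norm a \<le> R" "norm b \<le> R" for a b :: complex
      proof (rule norm_rGamma_le)
        have "norm (a * of_nat k + b) \<le> norm a * k + norm b"
          by (rule order.trans[OF norm_triangle_ineq]) (simp add: norm_mult)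
        also have "\<dots> \<le> R * k + R * k"
          using that k mult_left_mono[OF k(2) \<open>R \<ge> 0\<close>] by (intro add_mono mult_right_mono) auto
        finally show "norm (a * of_nat k + b) \<le> 2 * R * k" by simp
      qed (use k in auto)
      have "\<delta> * k - 2 * R \<le> Re (a1 + a2) * k + Re (b1 + b2)"
        using bd(2,4) abs_Re_le_cmod[of b1] abs_Re_le_cmod[of b2] mult_right_mono[OF bd(5), of "real k"]
        by simp
      then have "(\<delta> * k - 2 * R) * ln k \<le> (Re (a1 + a2) * k + Re (b1 + b2)) * ln k"
        using k by (intro mult_right_mono) auto
      moreover have "R * ln k \<le> R * k"
        using k \<open>R \<ge> 0\<close> ln_le_minus_one[of "real k"] by (intro mult_left_mono) auto
      ultimately have le: "((2 * R + 1) * (2 * R + 2) * k - Re (a1 * of_nat k + b1) * ln k)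
          + ((2 * R + 1) * (2 * R + 2) * k - Re (a2 * of_nat k + b2) * ln k)
          \<le> k * (C - \<delta> * ln k)"
        by (simp add: C_def algebra_simps)
      have "norm (rGamma (a1 * of_nat k + b1)) * norm (rGamma (a2 * of_nat k + b2))
          \<le> exp (k * (C - \<delta> * ln k))"
        by (rule order.trans[OF mult_mono[OF *[OF bd(1,2)] *[OF bd(3,4)]]])
           (use le in \<open>auto simp flip: exp_add\<close>)
      then have "norm (rGamma (a1 * of_nat k + b1) * rGamma (a2 * of_nat k + b2) * z ^ k)
          \<le> exp (k * (C - \<delta> * ln k)) * norm z ^ k"
        unfolding norm_mult norm_power by (rule mult_right_mono) simp
      also have "\<dots> = (exp C * norm z * real k powr - \<delta>) ^ k"
      proof -
        have "exp (C - \<delta> * ln k) = exp C * real k powr - \<delta>"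
          using k by (simp add: powr_def flip: exp_add)
        then show ?thesis
          by (simp add: exp_of_nat_mult power_mult_distrib)
      qed
      also have "\<dots> \<le> (1 / 2) ^ k"
        using elim by (intro power_mono) auto
      finally show "norm (rGamma (a1 * of_nat k + b1) * rGamma (a2 * of_nat k + b2) * z ^ k) \<le> (1 / 2) ^ k" .
    qed
  qed
qed

section \<open>Termwise differentiation along a line in the parameters\<close>

lemma has_field_derivative_rGamma_Digamma_over_Gamma:
  "(rGamma has_field_derivative - Digamma_over_Gamma w) (at w)"
  unfolding Digamma_over_Gamma_eq_deriv
  using holomorphic_derivI[OF holomorphic_rGamma[of UNIV]] by simp

text \<open>
  The direction \<open>(p, q) = (1, 0)\<close> is the derivative in \<open>\<alpha>\<^sub>1\<close>, and \<open>(0, 1)\<close> the one in \<open>\<beta>\<^sub>1\<close>.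
\<close>

lemma termwise_derivative_affine:
  fixes a1 b1 a2 b2 p q z :: complex
  assumes pos: "Re (a1 + a2) > 0" and pq: "norm p \<le> 1" "norm q \<le> 1"
  defines "f \<equiv> \<lambda>k t. rGamma ((a1 + p * t) * of_nat k + (b1 + q * t))
    * rGamma (a2 * of_nat k + b2) * z ^ k"
  defines "D \<equiv> \<lambda>k. (p * of_nat k + q) * (Digamma_over_Gamma (a1 * of_nat k + b1)
    * rGamma (a2 * of_nat k + b2) * z ^ k)"
  shows "summable (\<lambda>k. f k 0)" "summable D"
    "((\<lambda>t. \<Sum>k. f k t) has_field_derivative - (\<Sum>k. D k)) (at 0)"
proof -
  \<comment> \<open>Moving \<open>a1\<close> by less than half of \<open>Re (a1 + a2)\<close> leaves
    a real part of at least \<open>\<delta>\<close>. The summand \<open>\<delta>\<close> in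
    \<open>R\<close> leaves room for the displacements \<open>p * t\<close> and
    \<open>q * t\<close>.\<close>
  define \<delta> where "\<delta> = Re (a1 + a2) / 2"
  define R where "R = norm a1 + norm b1 + norm a2 + norm b2 + \<delta>"
  have \<delta>: "\<delta> > 0" using pos by (simp add: \<delta>_def)
  define S where "S = ball (0 :: complex) \<delta>"
  define f' where "f' = (\<lambda>k t. - (p * of_nat k + q) *
    (Digamma_over_Gamma ((a1 + p * t) * of_nat k + (b1 + q * t)) * rGamma (a2 * of_nat k + b2) * z ^ k))"
  have small: "norm (c * t) \<le> \<delta>" if "norm c \<le> 1" "t \<in> S" for c t :: complex
    using mult_mono[OF that(1), of "norm t" \<delta>] that(2) \<delta> by (simp add: S_def norm_mult)
  have R: "norm (a1 + p * t) \<le> R" "norm (b1 + q * t) \<le> R" "norm a2 \<le> R" "norm b2 \<le> R"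
    "Re ((a1 + p * t) + a2) \<ge> \<delta>" if "t \<in> S" for t
  proof -
    have nonneg: "norm a1 \<ge> 0" "norm b1 \<ge> 0" "norm a2 \<ge> 0" "norm b2 \<ge> 0" by auto
    show "norm (a1 + p * t) \<le> R" "norm (b1 + q * t) \<le> R" "norm a2 \<le> R" "norm b2 \<le> R"
      using small[OF pq(1) that] small[OF pq(2) that] norm_triangle_ineq[of a1 "p * t"]
        norm_triangle_ineq[of b1 "q * t"] \<delta> nonneg
      unfolding R_def by linarith+
    show "Re ((a1 + p * t) + a2) \<ge> \<delta>"
      using order.trans[OF abs_Re_le_cmod small[OF pq(1) that]]
      by (simp only: \<delta>_def plus_complex.sel abs_le_iff) argo
  qed
  have "R \<ge> 0" using \<delta> by (simp add: R_def)
  have bound: "\<forall>\<^sub>F k in sequentially. \<forall>t\<in>S. norm (f k t) \<le> (1 / 2) ^ k"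
    using eventually_norm_mittag_leffler4_term_le[OF \<delta> \<open>R \<ge> 0\<close>, of z]
  proof eventually_elim
    case (elim k)
    show ?case
      unfolding f_def by (intro ballI elim[rule_format] R)
  qed
  \<comment> \<open>Weierstrass's theorem: locally uniform domination of the holomorphic terms also
    gives convergence of the derivative series, to the derivative of the sum.\<close>
  have "\<exists>g g'. \<forall>t\<in>S. ((\<lambda>k. f k t) sums g t) \<and> ((\<lambda>k. f' k t) sums g' t)
      \<and> (g has_field_derivative g' t) (at t)"
  proof (rule series_and_derivative_comparison_complex)
    show "open S" by (simp add: S_def)
    show "(f k has_field_derivative f' k t) (at t)" if "t \<in> S" for k t
    proof -
      have "((\<lambda>t. (a1 + p * t) * of_nat k + (b1 + q * t)) has_field_derivative p * of_nat k + q) (at t)"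
        by (auto intro!: derivative_eq_intros)
      from DERIV_chain2[OF has_field_derivative_rGamma_Digamma_over_Gamma this]
      have "(f k has_field_derivative - Digamma_over_Gamma ((a1 + p * t) * of_nat k + (b1 + q * t)) *
          (p * of_nat k + q) * rGamma (a2 * of_nat k + b2) * z ^ k) (at t)"
        unfolding f_def by (intro DERIV_cmult_right)
      then show ?thesis
        by (rule DERIV_cong) (simp add: f'_def algebra_simps)
    qed
    \<comment> \<open>The bound is uniform on \<open>S\<close>, so the radius 1 is an arbitrary
      choice. The majorant has to be complex-valued with nonnegative real values, hence
      \<open>(1 / 2) ^ k\<close> as a complex sequence.\<close>
    show "\<exists>d (h :: nat \<Rightarrow> complex). 0 < d \<and> summable h \<and> range h \<subseteq> \<real>\<^sub>\<ge>\<^sub>0 \<and>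
        (\<forall>\<^sub>F k in sequentially. \<forall>y\<in>ball t d \<inter> S. norm (f k y) \<le> norm (h k))" if "t \<in> S" for t
    proof (intro exI conjI)
      show "summable (\<lambda>k. (1 / 2) ^ k :: complex)"
        by (intro summable_geometric) (simp add: norm_divide)
      show "range (\<lambda>k. (1 / 2) ^ k :: complex) \<subseteq> \<real>\<^sub>\<ge>\<^sub>0"
      proof -
        have "(1 / 2 :: complex) ^ k = of_real ((1 / 2) ^ k)" for k
          by simp
        then show ?thesis
          by (auto simp only: nonneg_Reals_of_real_iff) simp
      qed
      show "\<forall>\<^sub>F k in sequentially. \<forall>y\<in>ball t 1 \<inter> S. norm (f k y) \<le> norm ((1 / 2) ^ k :: complex)"
        using bound by eventually_elim (auto simp: norm_power norm_divide)
    qed auto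
  qed
  then obtain g g' where g: "\<And>t. t \<in> S \<Longrightarrow> (\<lambda>k. f k t) sums g t"
    "\<And>t. t \<in> S \<Longrightarrow> (\<lambda>k. f' k t) sums g' t"
    "\<And>t. t \<in> S \<Longrightarrow> (g has_field_derivative g' t) (at t)" by blast
  have 0: "0 \<in> S" using \<delta> by (simp add: S_def)
  show "summable (\<lambda>k. f k 0)" using g(1)[OF 0] by (simp add: sums_iff)
  have "(\<lambda>k. - f' k 0) sums - g' 0"
    by (intro sums_minus g 0)
  moreover have "(\<lambda>k. - f' k 0) = D" by (simp add: f'_def D_def fun_eq_iff algebra_simps)
  ultimately have D: "D sums - g' 0" by simp
  then show "summable D" by (simp add: sums_iff)
  \<comment> \<open>The function \<open>g\<close> is known to be the sum only on \<open>S\<close>;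
    the derivative carries over because \<open>S\<close> is an open neighbourhood of 0.\<close>
  have "((\<lambda>t. \<Sum>k. f k t) has_field_derivative g' 0) (at 0)"
    using g(3)[OF 0]
  proof (rule has_field_derivative_transform_within_open)
    show "open S" by (simp add: S_def)
    show "g t = (\<Sum>k. f k t)" if "t \<in> S" for t
      using g(1)[OF that] by (simp add: sums_iff)
  qed (use 0 in auto)
  then show "((\<lambda>t. \<Sum>k. f k t) has_field_derivative - (\<Sum>k. D k)) (at 0)"
    using D by (simp add: sums_iff)
qed

section \<open>Derivatives in the individual parameters\<close>

text \<open>This is the case \<open>j = 1\<close>; the two pairs of parameters enter symmetrically,
  so exchanging them gives \<open>j = 2\<close>.\<close>

lemma mittag_leffler4_derivative:
  fixes a1 b1 a2 b2 z :: complex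
  assumes pos: "Re (a1 + a2) > 0"
  shows "summable (\<lambda>k. rGamma (a1 * of_nat k + b1) * rGamma (a2 * of_nat k + b2) * z ^ k)"
    and "summable (\<lambda>k. of_nat (Suc k) * Digamma_over_Gamma (a1 * of_nat (Suc k) + b1)
        * rGamma (a2 * of_nat (Suc k) + b2) * z ^ Suc k)"
    and "((\<lambda>a. mittag_leffler4 a b1 a2 b2 z) has_field_derivative
          - (\<Sum>k. of_nat (Suc k) * Digamma_over_Gamma (a1 * of_nat (Suc k) + b1)
              * rGamma (a2 * of_nat (Suc k) + b2) * z ^ Suc k)) (at a1)"
    and "summable (\<lambda>k. Digamma_over_Gamma (a1 * of_nat k + b1)
        * rGamma (a2 * of_nat k + b2) * z ^ k)"
    and "((\<lambda>b. mittag_leffler4 a1 b a2 b2 z) has_field_derivative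
          - (\<Sum>k. Digamma_over_Gamma (a1 * of_nat k + b1)
              * rGamma (a2 * of_nat k + b2) * z ^ k)) (at b1)"
proof -
  note A = termwise_derivative_affine[OF pos, where p = 1 and q = 0 and ?b1.0 = b1 and ?b2.0 = b2 and z = z, simplified]
  note B = termwise_derivative_affine[OF pos, where p = 0 and q = 1 and ?b1.0 = b1 and ?b2.0 = b2 and z = z, simplified]
  let ?h = "\<lambda>k. of_nat k * (Digamma_over_Gamma (a1 * of_nat k + b1)
    * rGamma (a2 * of_nat k + b2) * z ^ k)"
  have h: "(\<lambda>k. of_nat (Suc k) * Digamma_over_Gamma (a1 * of_nat (Suc k) + b1)
      * rGamma (a2 * of_nat (Suc k) + b2) * z ^ Suc k) = (\<lambda>k. ?h (Suc k))"
    by (simp only: mult.assoc)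
  show "summable (\<lambda>k. rGamma (a1 * of_nat k + b1) * rGamma (a2 * of_nat k + b2) * z ^ k)"
    by (rule A(1))
  have h_summable: "summable ?h"
    using A(2) by (simp only: mult.assoc)
  then show "summable (\<lambda>k. of_nat (Suc k) * Digamma_over_Gamma (a1 * of_nat (Suc k) + b1)
      * rGamma (a2 * of_nat (Suc k) + b2) * z ^ Suc k)"
    unfolding h by (subst summable_Suc_iff)
  \<comment> \<open>The term at \<open>k = 0\<close> vanishes through its factor \<open>k\<close>,
    so starting the sum at 1 or at 0 makes no difference.\<close>
  have "(\<Sum>k. ?h (Suc k)) = (\<Sum>k. ?h k)"
    using suminf_split_head[OF h_summable] by simp
  \<comment> \<open>The affine lemma differentiates
    \<open>t \<mapsto> mittag_leffler4 (a1 + t) b1 a2 b2 z\<close> at 0; \<open>DERIV_shift\<close>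
    moves the base point to \<open>a1\<close>.\<close>
  moreover have "((\<lambda>a. mittag_leffler4 a b1 a2 b2 z) has_field_derivative - (\<Sum>k. ?h k)) (at a1)"
    using A(3) DERIV_shift[of "\<lambda>a. mittag_leffler4 a b1 a2 b2 z" _ 0 a1]
    by (simp add: mittag_leffler4_def add.commute mult.assoc)
  ultimately show "((\<lambda>a. mittag_leffler4 a b1 a2 b2 z) has_field_derivative
      - (\<Sum>k. of_nat (Suc k) * Digamma_over_Gamma (a1 * of_nat (Suc k) + b1)
          * rGamma (a2 * of_nat (Suc k) + b2) * z ^ Suc k)) (at a1)"
    unfolding h by (simp only:)
  show "summable (\<lambda>k. Digamma_over_Gamma (a1 * of_nat k + b1) * rGamma (a2 * of_nat k + b2) * z ^ k)"
    by (rule B(2))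
  show "((\<lambda>b. mittag_leffler4 a1 b a2 b2 z) has_field_derivative
      - (\<Sum>k. Digamma_over_Gamma (a1 * of_nat k + b1) * rGamma (a2 * of_nat k + b2) * z ^ k)) (at b1)"
    using B(3) DERIV_shift[of "\<lambda>b. mittag_leffler4 a1 b a2 b2 z" _ 0 b1]
    by (simp add: mittag_leffler4_def add.commute)
qed

lemma mittag_leffler4_commute:
  "mittag_leffler4 a1 b1 a2 b2 z = mittag_leffler4 a2 b2 a1 b1 z"
  unfolding mittag_leffler4_def by (simp only: mult.commute)

theorem corollary2p1:
  fixes \<alpha>\<^sub>1 \<beta>\<^sub>1 \<alpha>\<^sub>2 \<beta>\<^sub>2 z :: complex
  assumes "(\<alpha>\<^sub>1, \<beta>\<^sub>1, \<alpha>\<^sub>2, \<beta>\<^sub>2) \<in> D4"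
  shows
    "summable (\<lambda>k. rGamma (\<alpha>\<^sub>1 * of_nat k + \<beta>\<^sub>1) * rGamma (\<alpha>\<^sub>2 * of_nat k + \<beta>\<^sub>2) * z ^ k)
     \<and> summable (\<lambda>k. of_nat (Suc k) * Digamma_over_Gamma (\<alpha>\<^sub>1 * of_nat (Suc k) + \<beta>\<^sub>1)
        * rGamma (\<alpha>\<^sub>2 * of_nat (Suc k) + \<beta>\<^sub>2) * z ^ Suc k)
     \<and> ((\<lambda>a. mittag_leffler4 a \<beta>\<^sub>1 \<alpha>\<^sub>2 \<beta>\<^sub>2 z) has_field_derivative
          - (\<Sum>k. of_nat (Suc k) * Digamma_over_Gamma (\<alpha>\<^sub>1 * of_nat (Suc k) + \<beta>\<^sub>1)
              * rGamma (\<alpha>\<^sub>2 * of_nat (Suc k) + \<beta>\<^sub>2) * z ^ Suc k)) (at \<alpha>\<^sub>1)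
     \<and> summable (\<lambda>k. of_nat (Suc k) * Digamma_over_Gamma (\<alpha>\<^sub>2 * of_nat (Suc k) + \<beta>\<^sub>2)
        * rGamma (\<alpha>\<^sub>1 * of_nat (Suc k) + \<beta>\<^sub>1) * z ^ Suc k)
     \<and> ((\<lambda>a. mittag_leffler4 \<alpha>\<^sub>1 \<beta>\<^sub>1 a \<beta>\<^sub>2 z) has_field_derivative
          - (\<Sum>k. of_nat (Suc k) * Digamma_over_Gamma (\<alpha>\<^sub>2 * of_nat (Suc k) + \<beta>\<^sub>2)
              * rGamma (\<alpha>\<^sub>1 * of_nat (Suc k) + \<beta>\<^sub>1) * z ^ Suc k)) (at \<alpha>\<^sub>2)
     \<and> summable (\<lambda>k. Digamma_over_Gamma (\<alpha>\<^sub>1 * of_nat k + \<beta>\<^sub>1)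
        * rGamma (\<alpha>\<^sub>2 * of_nat k + \<beta>\<^sub>2) * z ^ k)
     \<and> ((\<lambda>b. mittag_leffler4 \<alpha>\<^sub>1 b \<alpha>\<^sub>2 \<beta>\<^sub>2 z) has_field_derivative
          - (\<Sum>k. Digamma_over_Gamma (\<alpha>\<^sub>1 * of_nat k + \<beta>\<^sub>1)
              * rGamma (\<alpha>\<^sub>2 * of_nat k + \<beta>\<^sub>2) * z ^ k)) (at \<beta>\<^sub>1)
     \<and> summable (\<lambda>k. Digamma_over_Gamma (\<alpha>\<^sub>2 * of_nat k + \<beta>\<^sub>2)
        * rGamma (\<alpha>\<^sub>1 * of_nat k + \<beta>\<^sub>1) * z ^ k)
     \<and> ((\<lambda>b. mittag_leffler4 \<alpha>\<^sub>1 \<beta>\<^sub>1 \<alpha>\<^sub>2 b z) has_field_derivative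
          - (\<Sum>k. Digamma_over_Gamma (\<alpha>\<^sub>2 * of_nat k + \<beta>\<^sub>2)
              * rGamma (\<alpha>\<^sub>1 * of_nat k + \<beta>\<^sub>1) * z ^ k)) (at \<beta>\<^sub>2)"
proof -
  have pos: "Re (\<alpha>\<^sub>1 + \<alpha>\<^sub>2) > 0" "Re (\<alpha>\<^sub>2 + \<alpha>\<^sub>1) > 0"
    using assms by (auto simp: D4_def)
  note first = mittag_leffler4_derivative[OF pos(1), where ?b1.0 = \<beta>\<^sub>1 and ?b2.0 = \<beta>\<^sub>2 and z = z]
  note second = mittag_leffler4_derivative[OF pos(2), where ?b1.0 = \<beta>\<^sub>2 and ?b2.0 = \<beta>\<^sub>1 and z = z]
  \<comment> \<open>For \<open>j = 2\<close> the claimed series already have the factor with index 2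
    in front, as in \<open>second\<close>; only the differentiated function needs its pairs
    exchanged.\<close>
  have swap: "(\<lambda>a. mittag_leffler4 \<alpha>\<^sub>1 \<beta>\<^sub>1 a \<beta>\<^sub>2 z) = (\<lambda>a. mittag_leffler4 a \<beta>\<^sub>2 \<alpha>\<^sub>1 \<beta>\<^sub>1 z)"
    "(\<lambda>b. mittag_leffler4 \<alpha>\<^sub>1 \<beta>\<^sub>1 \<alpha>\<^sub>2 b z) = (\<lambda>b. mittag_leffler4 \<alpha>\<^sub>2 b \<alpha>\<^sub>1 \<beta>\<^sub>1 z)"
    by (intro ext mittag_leffler4_commute)+
  show ?thesis
    unfolding swap by (intro conjI first second)
qed

end
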